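(* Let $X$ be a Hausdorff space and $\mu$ a Radon valuation on $X$. Assume that $\mu_*(U)>0$ for all non-empty open sets $U\subset X$, or equivalently that for all non-empty open sets $U$ there exists $K\subset U$ compact with $\mu(K)>0$. Then the map $$p_\mu:X^\mu\rightarrow X$$ is dense. In particular, for any Hausdorff locale $Y$, precomposition with $p_\mu$ induces an injection $$\mathrm{Map}(X,Y)\rightarrow\mathrm{Map}(X^\mu,Y).$$
   Context: A frame is a poset with arbitrary suprema and finite infima satisfying $V\wedge\bigvee_i U_i=\bigvee_i(V\wedge U_i)$; locales are the objects of the opposite category of frames, $\mathcal{O}(L)$ is the frame of $L$, and a continuous map $f:L\to M$ is a frame homomorphism $f^*:\mathcal{O}(M)\to\mathcal{O}(L)$ with right adjoint $f_*$. $\mathrm{Map}(L,M)$ is the set of continuous maps of locales $L\to M$. Hausdorff spaces are identified with the locales of their frames of opens. A continuous map $f$ is dense if $f_*(0)=0$. A locale $Y$ is Hausdorff (Isbell-Hausdorff) if the diagonal $Y\to Y\times Y$ (product in locales) is a closed map of locales. For a Hausdorff space $X$, $\mathcal{K}(X)$ is the lattice of compact subsets. A Radon valuation on $X$ is a map $\mu:\mathcal{K}(X)\to[0,\infty)$ that is monotone, with $\mu(\emptyset)=0$, $\mu(C)+\mu(D)=\mu(C\cup D)+\mu(C\cap D)$, and almost Boolean: for any compact $C$, any ascending sequence of compacts $C_0\subset C_1\subset\cdots\subset C$ and any $\epsilon>0$ there are $N\in\mathbb{N}$ and a compact $D\subset C$ with $\mu(D\cap C_n)=0$ for all $n$ and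 $\mu(C)-\mu(D\cup C_N)<\epsilon$. A $\mu$-ideal is a downward closed $U\subset\mathcal{K}(X)$ such that $K\in U$ whenever there are $K_i\in U$ $(i\in I)$, $K_i\subset K$, such that for all $\epsilon>0$ some finite $F\subset I$ has $\mu(K)-\mu(\bigcup_{i\in F}K_i)<\epsilon$. The $\mu$-ideals ordered by inclusion form the frame of a locale $X^\mu$. The map $p_\mu:X^\mu\to X$ has inverse image sending an open $V\subset X$ to the smallest $\mu$-ideal containing $\{K\subset V\mid K\text{ compact}\}$. For $U\subset X$ open, $\mu_*(U)=\sup\{\mu(K)\mid K\subset U\text{ compact}\}$. *)

theory Defs
  imports "HOL-Analysis.Analysis" "HOL-Algebra.Galois_Connection"
begin

section \<open>Frames and locales\<close>

text \<open>
  A locale is represented by its frame of opens, an ordered structure in the style of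
  HOL-Algebra.  (Frames have all joins, hence all meets, so they are complete lattices.)
\<close>

locale frame = complete_lattice L for L (structure) +
  assumes inf_Sup_distrib:
    "\<lbrakk>V \<in> carrier L; A \<subseteq> carrier L\<rbrakk> \<Longrightarrow> V \<sqinter> (\<Squnion>A) = \<Squnion>((\<lambda>U. V \<sqinter> U) ` A)"

text \<open>
  A continuous map \<open>f : L \<rightarrow> M\<close> is represented by its inverse image
  \<open>f\<^sup>* : O(M) \<rightarrow> O(L)\<close>.  It is required to be extensional, so that two elements of
  \<open>cont_maps L M\<close> are equal iff they agree on \<open>carrier M\<close>.  Accordingly the composite
  of \<open>f : L \<rightarrow> M\<close> and \<open>g : M \<rightarrow> N\<close> is \<open>compose (carrier N) f g\<close>.
\<close>

definition cont_maps ::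
  "('a, 'c) gorder_scheme \<Rightarrow> ('b, 'd) gorder_scheme \<Rightarrow> ('b \<Rightarrow> 'a) set" where
  "cont_maps L M = {f \<in> carrier M \<rightarrow>\<^sub>E carrier L.
     frame L \<and> frame M \<and> sup_pres M L f \<and> meet_pres M L f \<and> f \<top>\<^bsub>M\<^esub> = \<top>\<^bsub>L\<^esub>}"

text \<open>The right adjoint \<open>f\<^sub>*\<close> of \<open>f\<^sup>*\<close>.\<close>

definition direct_image ::
  "('a, 'c) gorder_scheme \<Rightarrow> ('b, 'd) gorder_scheme \<Rightarrow> ('b \<Rightarrow> 'a) \<Rightarrow> 'a \<Rightarrow> 'b" where
  "direct_image L M f x = \<Squnion>\<^bsub>M\<^esub>{y \<in> carrier M. f y \<sqsubseteq>\<^bsub>L\<^esub> x}"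

lemma direct_image_closed:
  assumes "f \<in> cont_maps L M" shows "direct_image L M f x \<in> carrier M"
proof -
  interpret M: frame M using assms by (simp add: cont_maps_def)
  show ?thesis unfolding direct_image_def by (rule M.sup_closed) auto
qed

lemma galois_direct_image:
  assumes f: "f \<in> cont_maps L M" and x: "x \<in> carrier L" and y: "y \<in> carrier M"
  shows "f y \<sqsubseteq>\<^bsub>L\<^esub> x \<longleftrightarrow> y \<sqsubseteq>\<^bsub>M\<^esub> direct_image L M f x"
proof -
  interpret L: frame L using f by (simp add: cont_maps_def)
  interpret M: frame M using f by (simp add: cont_maps_def)
  have fc: "f \<in> carrier M \<rightarrow> carrier L" and sp: "\<And>A. A \<subseteq> carrier M \<Longrightarrow> f (\<Squnion>\<^bsub>M\<^esub>A) = \<Squnion>\<^bsub>L\<^esub>(f ` A)"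
    and iso: "isotone M L f"
    using f meet_pres_isotone[of f M L] by (auto simp: cont_maps_def sup_pres_def)
  let ?A = "{y \<in> carrier M. f y \<sqsubseteq>\<^bsub>L\<^esub> x}"
  have d: "direct_image L M f x \<in> carrier M" by (rule direct_image_closed[OF f])
  have "f (direct_image L M f x) = \<Squnion>\<^bsub>L\<^esub>(f ` ?A)"
    unfolding direct_image_def by (rule sp) auto
  also have "\<dots> \<sqsubseteq>\<^bsub>L\<^esub> x" by (rule L.sup_least) (use fc x in auto)
  finally have 1: "f (direct_image L M f x) \<sqsubseteq>\<^bsub>L\<^esub> x" .
  show ?thesis
  proof
    assume "f y \<sqsubseteq>\<^bsub>L\<^esub> x"
    then show "y \<sqsubseteq>\<^bsub>M\<^esub> direct_image L M f x"
      unfolding direct_image_def by (intro M.sup_upper) (use y in auto)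
  next
    assume "y \<sqsubseteq>\<^bsub>M\<^esub> direct_image L M f x"
    then have "f y \<sqsubseteq>\<^bsub>L\<^esub> f (direct_image L M f x)"
      using iso y d by (auto simp: isotone_def)
    then show "f y \<sqsubseteq>\<^bsub>L\<^esub> x" using 1 fc x y d by (intro L.le_trans[of "f y" "f (direct_image L M f x)" x]) auto
  qed
qed

definition dense_map ::
  "('a, 'c) gorder_scheme \<Rightarrow> ('b, 'd) gorder_scheme \<Rightarrow> ('b \<Rightarrow> 'a) \<Rightarrow> bool" where
  "dense_map L M f \<longleftrightarrow> f \<in> cont_maps L M \<and> direct_image L M f \<bottom>\<^bsub>L\<^esub> = \<bottom>\<^bsub>M\<^esub>"

text \<open>
  Sublocales of \<open>L\<close> are viewed as subsets of \<open>O(L)\<close>: the closed sublocale complementary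
  to the open \<open>a\<close> is the principal filter of \<open>a\<close>, and the image of a sublocale under
  \<open>f\<close> is its set-theoretic image under \<open>f\<^sub>*\<close>.  A map is closed if images of closed
  sublocales are closed.
\<close>

definition closed_sublocale :: "('a, 'c) gorder_scheme \<Rightarrow> 'a set \<Rightarrow> bool" where
  "closed_sublocale L S \<longleftrightarrow> (\<exists>a\<in>carrier L. S = {x \<in> carrier L. a \<sqsubseteq>\<^bsub>L\<^esub> x})"

definition closed_locale_map ::
  "('a, 'c) gorder_scheme \<Rightarrow> ('b, 'd) gorder_scheme \<Rightarrow> ('b \<Rightarrow> 'a) \<Rightarrow> bool" where
  "closed_locale_map L M f \<longleftrightarrow> f \<in> cont_maps L M \<and>
     (\<forall>S. closed_sublocale L S \<longrightarrow> closed_sublocale M (direct_image L M f ` S))"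

abbreviation incl_order :: "'a set set \<Rightarrow> 'a set gorder" where
  "incl_order C \<equiv> \<lparr>carrier = C, eq = (=), le = (\<subseteq>)\<rparr>"

text \<open>
  The frame of the product locale \<open>Y \<times> Z\<close> is the coproduct of frames, constructed as usual
  as the down-closed sets of rectangles closed under joins in each variable (a set \<open>D\<close>
  stands for the join of the rectangles \<open>a \<times> b\<close> with \<open>(a, b) \<in> D\<close>).  The empty joins
  make every \<open>D\<close> contain all \<open>(\<bottom>, z)\<close> and \<open>(y, \<bottom>)\<close>.
\<close>

definition rect_ideal ::
  "('a, 'c) gorder_scheme \<Rightarrow> ('b, 'd) gorder_scheme \<Rightarrow> ('a \<times> 'b) set \<Rightarrow> bool" where
  "rect_ideal Y Z D \<longleftrightarrow> D \<subseteq> carrier Y \<times> carrier Z \<and>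
     (\<forall>(y, z)\<in>D. \<forall>y'\<in>carrier Y. \<forall>z'\<in>carrier Z.
        y' \<sqsubseteq>\<^bsub>Y\<^esub> y \<and> z' \<sqsubseteq>\<^bsub>Z\<^esub> z \<longrightarrow> (y', z') \<in> D) \<and>
     (\<forall>A\<subseteq>carrier Y. \<forall>z\<in>carrier Z. A \<times> {z} \<subseteq> D \<longrightarrow> (\<Squnion>\<^bsub>Y\<^esub>A, z) \<in> D) \<and>
     (\<forall>y\<in>carrier Y. \<forall>B\<subseteq>carrier Z. {y} \<times> B \<subseteq> D \<longrightarrow> (y, \<Squnion>\<^bsub>Z\<^esub>B) \<in> D)"

definition prod_locale ::
  "('a, 'c) gorder_scheme \<Rightarrow> ('b, 'd) gorder_scheme \<Rightarrow> ('a \<times> 'b) set gorder" where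
  "prod_locale Y Z = incl_order {D. rect_ideal Y Z D}"

text \<open>
  The map \<open>(f, g) : L \<rightarrow> Y \<times> Z\<close> induced by \<open>f : L \<rightarrow> Y\<close> and \<open>g : L \<rightarrow> Z\<close>: the inverse
  image of a rectangle \<open>y \<times> z\<close> is \<open>f\<^sup>*(y) \<and> g\<^sup>*(z)\<close>.  The diagonal is \<open>(id, id)\<close>.
\<close>

definition pair_map ::
  "('e, 'g) gorder_scheme \<Rightarrow> ('a, 'c) gorder_scheme \<Rightarrow> ('b, 'd) gorder_scheme \<Rightarrow>
    ('a \<Rightarrow> 'e) \<Rightarrow> ('b \<Rightarrow> 'e) \<Rightarrow> ('a \<times> 'b) set \<Rightarrow> 'e" where
  "pair_map L Y Z f g =
     (\<lambda>D\<in>carrier (prod_locale Y Z). \<Squnion>\<^bsub>L\<^esub>((\<lambda>(y, z). f y \<sqinter>\<^bsub>L\<^esub> g z) ` D))"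

definition id_map :: "('a, 'c) gorder_scheme \<Rightarrow> 'a \<Rightarrow> 'a" where
  "id_map Y = (\<lambda>y\<in>carrier Y. y)"

definition diagonal :: "('a, 'c) gorder_scheme \<Rightarrow> ('a \<times> 'a) set \<Rightarrow> 'a" where
  "diagonal Y = pair_map Y Y Y (id_map Y) (id_map Y)"

definition Hausdorff_locale :: "('a, 'c) gorder_scheme \<Rightarrow> bool" where
  "Hausdorff_locale Y \<longleftrightarrow> frame Y \<and> closed_locale_map Y (prod_locale Y Y) (diagonal Y)"

definition opens_locale :: "'a topology \<Rightarrow> 'a set gorder" where
  "opens_locale X = incl_order {U. openin X U}"


section \<open>Radon valuations\<close>

text \<open>
  A valuation on \<open>\<K>(X)\<close> is given by a function on all sets, of which only the values on
  compact sets matter.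
\<close>

definition almost_Boolean :: "'a topology \<Rightarrow> ('a set \<Rightarrow> real) \<Rightarrow> bool" where
  "almost_Boolean X \<mu> \<longleftrightarrow>
     (\<forall>C (Cs :: nat \<Rightarrow> 'a set) \<epsilon>.
        compactin X C \<and> (\<forall>n. compactin X (Cs n)) \<and>
        (\<forall>n. Cs n \<subseteq> Cs (Suc n)) \<and> (\<forall>n. Cs n \<subseteq> C) \<and> \<epsilon> > 0 \<longrightarrow>
        (\<exists>N D. compactin X D \<and> D \<subseteq> C \<and> (\<forall>n. \<mu> (D \<inter> Cs n) = 0) \<and>
               \<mu> C - \<mu> (D \<union> Cs N) < \<epsilon>))"

definition radon_valuation :: "'a topology \<Rightarrow> ('a set \<Rightarrow> real) \<Rightarrow> bool" where
  "radon_valuation X \<mu> \<longleftrightarrow>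
     (\<forall>C. compactin X C \<longrightarrow> \<mu> C \<ge> 0) \<and>
     (\<forall>C D. compactin X C \<and> compactin X D \<and> C \<subseteq> D \<longrightarrow> \<mu> C \<le> \<mu> D) \<and>
     \<mu> {} = 0 \<and>
     (\<forall>C D. compactin X C \<and> compactin X D \<longrightarrow> \<mu> C + \<mu> D = \<mu> (C \<union> D) + \<mu> (C \<inter> D)) \<and>
     almost_Boolean X \<mu>"

text \<open>\<open>\<mu>\<^sub>*(U)\<close>, which may be infinite.\<close>

definition inner_val :: "'a topology \<Rightarrow> ('a set \<Rightarrow> real) \<Rightarrow> 'a set \<Rightarrow> ennreal" where
  "inner_val X \<mu> U = (SUP K\<in>{K. compactin X K \<and> K \<subseteq> U}. ennreal (\<mu> K))"

text \<open>
  The covering families \<open>(K\<^sub>i)\<close> are taken as sets \<open>\<F>\<close> of compacts, since the condition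
  depends only on the set of members of the family.
\<close>

definition mu_ideal :: "'a topology \<Rightarrow> ('a set \<Rightarrow> real) \<Rightarrow> 'a set set \<Rightarrow> bool" where
  "mu_ideal X \<mu> U \<longleftrightarrow> U \<subseteq> {K. compactin X K} \<and>
     (\<forall>K\<in>U. \<forall>C. compactin X C \<and> C \<subseteq> K \<longrightarrow> C \<in> U) \<and>
     (\<forall>K \<F>. compactin X K \<and> \<F> \<subseteq> U \<and> (\<forall>C\<in>\<F>. C \<subseteq> K) \<and>
        (\<forall>\<epsilon>>0. \<exists>F. finite F \<and> F \<subseteq> \<F> \<and> \<mu> K - \<mu> (\<Union>F) < \<epsilon>) \<longrightarrow> K \<in> U)"

definition valuation_locale :: "'a topology \<Rightarrow> ('a set \<Rightarrow> real) \<Rightarrow> 'a set set gorder" where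
  "valuation_locale X \<mu> = incl_order {U. mu_ideal X \<mu> U}"

definition p_map :: "'a topology \<Rightarrow> ('a set \<Rightarrow> real) \<Rightarrow> 'a set \<Rightarrow> 'a set set" where
  "p_map X \<mu> = (\<lambda>V\<in>{V. openin X V}. mu_ideal X \<mu> hull {K. compactin X K \<and> K \<subseteq> V})"

end

theory Submission
  imports Defs
begin

text \<open>
  If \<open>p\<^sub>\<mu>\<^sup>*(V)\<close> is the bottom \<open>\<mu>\<close>-ideal, every compact subset of \<open>V\<close> is null, because the
  null compacts form a \<open>\<mu>\<close>-ideal (\<open>mu_ideal_null\<close>); when every non-empty open set contains a
  compact of positive measure, this forces \<open>V = {}\<close>, which is density of \<open>p\<^sub>\<mu>\<close>.  Most of the
  work is to see that \<open>p\<^sub>\<mu>\<close> is a map of locales at all.  Approximate covers can be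
  intersected with a compact, so the \<open>\<mu>\<close>-ideals have a Heyting implication
  (\<open>mu_ideal_imp\<close>); hence they form a frame, and generating an ideal preserves binary
  intersections, which gives meets.  Joins come from splitting a compact
  covered by open sets into compacts inside its members (\<open>mu_ideal_compact_cover\<close>).

  Precomposition with any dense map is injective on maps to a Hausdorff locale \<open>Y\<close>.
  Classically, the equalizer of \<open>f\<close> and \<open>g\<close> is the inverse image of the diagonal, hence
  closed, and a dense map factoring through it makes it everything.  Neither equalizers nor the
  frame map of \<open>(f, g)\<close> are constructed here.  Closedness of the diagonal is condensed into a
  property of opens of \<open>Y \<times> Y\<close>, \<open>Hausdorff_locale_rect_swap\<close>: an open that contains the
  complement of the diagonal and \<open>u \<times> \<top>\<close> also contains \<open>\<top> \<times> u\<close>.  Applied to the open formed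
  by the rectangles \<open>y \<times> z\<close> with \<open>f\<^sup>*(y) \<and> g\<^sup>*(z) \<le> f\<^sup>*(u)\<close>, it yields
  \<open>g\<^sup>*(u) \<le> f\<^sup>*(u)\<close>, and equality by symmetry.
\<close>


section \<open>Frames of sets ordered by inclusion\<close>

text \<open>
  Both frames built from the space, its open sets and its \<open>\<mu>\<close>-ideals, have binary
  intersections as meets, and differ only in the operator \<open>S\<close> that forms joins: plain union
  for open sets, and the ideal generated by the union for \<open>\<mu>\<close>-ideals.
\<close>

locale set_frame =
  fixes C :: "'a set set" and S :: "'a set set \<Rightarrow> 'a set"
  assumes S_closed: "A \<subseteq> C \<Longrightarrow> S A \<in> C"
    and S_upper: "A \<subseteq> C \<Longrightarrow> U \<in> A \<Longrightarrow> U \<subseteq> S A"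
    and S_least: "A \<subseteq> C \<Longrightarrow> B \<in> C \<Longrightarrow> (\<And>U. U \<in> A \<Longrightarrow> U \<subseteq> B) \<Longrightarrow> S A \<subseteq> B"
    and Int_closed: "U \<in> C \<Longrightarrow> V \<in> C \<Longrightarrow> U \<inter> V \<in> C"
    and Int_S_subset: "V \<in> C \<Longrightarrow> A \<subseteq> C \<Longrightarrow> V \<inter> S A \<subseteq> S ((\<inter>) V ` A)"
begin

lemma partial_order: "partial_order (incl_order C)"
  by unfold_locales auto

lemma complete_lattice: "complete_lattice (incl_order C)"
proof -
  interpret partial_order "incl_order C" by (rule partial_order)
  show ?thesis
  proof
    fix A assume A: "A \<subseteq> carrier (incl_order C)"
    have "S A \<subseteq> B" if "B \<in> Upper (incl_order C) A" for B
      using A that by (intro S_least) (auto simp: Upper_def)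
    then show "\<exists>s. least (incl_order C) s (Upper (incl_order C) A)"
      using A S_closed[of A] S_upper[of A]
      by (intro exI[of _ "S A"] least_UpperI) auto
    \<comment> \<open>The meet of a family is the join of its lower bounds.\<close>
    let ?B = "{B \<in> C. \<forall>U\<in>A. B \<subseteq> U}"
    have B: "?B \<subseteq> C" by blast
    have "S ?B \<subseteq> U" if "U \<in> A" for U
      using S_least[OF B, of U] A that by auto
    moreover have "U \<subseteq> S ?B" if "U \<in> Lower (incl_order C) A" for U
      using A that by (intro S_upper[OF B]) (auto simp: Lower_def)
    ultimately show "\<exists>i. greatest (incl_order C) i (Lower (incl_order C) A)"
      using A S_closed[OF B] by (intro exI[of _ "S ?B"] greatest_LowerI) auto
  qed
qed

lemma sup_eq: "\<Squnion>\<^bsub>incl_order C\<^esub>A = S A" if A: "A \<subseteq> C"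
proof -
  interpret complete_lattice "incl_order C" by (rule complete_lattice)
  have "\<Squnion>\<^bsub>incl_order C\<^esub>A \<subseteq> S A"
    using sup_least[of A "S A"] S_closed[OF A] S_upper[OF A] A by auto
  moreover have "S A \<subseteq> \<Squnion>\<^bsub>incl_order C\<^esub>A"
    using S_least[OF A, of "\<Squnion>\<^bsub>incl_order C\<^esub>A"] sup_closed[of A] sup_upper[of A] A by auto
  ultimately show ?thesis by blast
qed

lemma meet_eq: "U \<sqinter>\<^bsub>incl_order C\<^esub> V = U \<inter> V" if "U \<in> C" "V \<in> C"
proof -
  interpret complete_lattice "incl_order C" by (rule complete_lattice)
  show ?thesis
    using meet_left[of U V] meet_right[of U V] meet_le[of "U \<inter> V" U V] Int_closed that by auto
qed

lemma top_eq: "\<top>\<^bsub>incl_order C\<^esub> = T" if "T \<in> C" "\<And>U. U \<in> C \<Longrightarrow> U \<subseteq> T"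
proof -
  interpret L: complete_lattice "incl_order C" by (rule complete_lattice)
  show ?thesis using L.top_closed L.top_higher[of T] that by (intro equalityI) auto
qed

lemma bottom_eq: "\<bottom>\<^bsub>incl_order C\<^esub> = B" if "B \<in> C" "\<And>U. U \<in> C \<Longrightarrow> B \<subseteq> U"
proof -
  interpret L: complete_lattice "incl_order C" by (rule complete_lattice)
  show ?thesis using L.bottom_closed L.bottom_lower[of B] that by (intro equalityI) auto
qed

lemma frame: "frame (incl_order C)"
proof -
  interpret complete_lattice "incl_order C" by (rule complete_lattice)
  show ?thesis
  proof
    fix V A assume "V \<in> carrier (incl_order C)" "A \<subseteq> carrier (incl_order C)"
    then have V: "V \<in> C" and A: "A \<subseteq> C" by auto
    have VA: "(\<inter>) V ` A \<subseteq> C" using V A Int_closed by blast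
    have "V \<inter> S A = S ((\<inter>) V ` A)"
      using Int_S_subset[OF V A] S_least[OF VA, of "V \<inter> S A"] S_upper[OF A]
        Int_closed[OF V S_closed[OF A]] by blast
    moreover have "(\<lambda>U. V \<sqinter>\<^bsub>incl_order C\<^esub> U) ` A = (\<inter>) V ` A"
      using meet_eq[OF V] A by (intro image_cong) auto
    ultimately show "V \<sqinter>\<^bsub>incl_order C\<^esub> \<Squnion>\<^bsub>incl_order C\<^esub>A
        = \<Squnion>\<^bsub>incl_order C\<^esub>((\<lambda>U. V \<sqinter>\<^bsub>incl_order C\<^esub> U) ` A)"
      using sup_eq[OF A] sup_eq[OF VA] meet_eq[OF V S_closed[OF A]] by simp
  qed
qed

end

lemma set_frame_opens: "set_frame {U. openin X U} \<Union>"
  by unfold_locales auto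


section \<open>Dense maps and Hausdorff locales\<close>

lemma cont_maps_D:
  assumes "f \<in> cont_maps L M"
  shows "frame L" "frame M"
    and "\<And>y. y \<in> carrier M \<Longrightarrow> f y \<in> carrier L"
    and "\<And>A. A \<subseteq> carrier M \<Longrightarrow> f (\<Squnion>\<^bsub>M\<^esub>A) = \<Squnion>\<^bsub>L\<^esub>(f ` A)"
    and "\<And>y z. y \<in> carrier M \<Longrightarrow> z \<in> carrier M \<Longrightarrow> f (y \<sqinter>\<^bsub>M\<^esub> z) = f y \<sqinter>\<^bsub>L\<^esub> f z"
    and "f \<top>\<^bsub>M\<^esub> = \<top>\<^bsub>L\<^esub>"
    and "\<And>y z. y \<in> carrier M \<Longrightarrow> z \<in> carrier M \<Longrightarrow> y \<sqsubseteq>\<^bsub>M\<^esub> z \<Longrightarrow> f y \<sqsubseteq>\<^bsub>L\<^esub> f z"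
    and "f \<in> extensional (carrier M)"
proof -
  have "isotone M L f"
    using assms meet_pres_isotone[of f M L] by (auto simp: cont_maps_def)
  then show "\<And>y z. y \<in> carrier M \<Longrightarrow> z \<in> carrier M \<Longrightarrow> y \<sqsubseteq>\<^bsub>M\<^esub> z \<Longrightarrow> f y \<sqsubseteq>\<^bsub>L\<^esub> f z"
    by (auto simp: isotone_def)
qed (use assms in \<open>auto simp: cont_maps_def sup_pres_def meet_pres_def PiE_def Pi_def\<close>)

lemma cont_mapsI:
  assumes "frame L" "frame M" "f \<in> extensional (carrier M)"
    and "\<And>y. y \<in> carrier M \<Longrightarrow> f y \<in> carrier L"
    and "\<And>A. A \<subseteq> carrier M \<Longrightarrow> f (\<Squnion>\<^bsub>M\<^esub>A) = \<Squnion>\<^bsub>L\<^esub>(f ` A)"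
    and "\<And>y z. y \<in> carrier M \<Longrightarrow> z \<in> carrier M \<Longrightarrow> f (y \<sqinter>\<^bsub>M\<^esub> z) = f y \<sqinter>\<^bsub>L\<^esub> f z"
    and "f \<top>\<^bsub>M\<^esub> = \<top>\<^bsub>L\<^esub>"
  shows "f \<in> cont_maps L M"
proof -
  interpret L: frame L by fact
  interpret M: frame M by fact
  show ?thesis
    using assms L.complete_lattice_axioms M.complete_lattice_axioms
      L.lattice_axioms M.lattice_axioms
    by (simp add: cont_maps_def sup_pres_def meet_pres_def PiE_iff)
qed

lemma id_map_cont:
  assumes "frame Y" shows "id_map Y \<in> cont_maps Y Y"
proof -
  interpret frame Y by fact
  have "id_map Y ` A = A" if "A \<subseteq> carrier Y" for A
    using that by (force simp: id_map_def)
  then show ?thesis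
    using assms by (intro cont_mapsI) (auto simp: id_map_def)
qed

lemma compose_cont_maps:
  assumes p: "p \<in> cont_maps L M" and f: "f \<in> cont_maps M N"
  shows "compose (carrier N) p f \<in> cont_maps L N"
proof -
  note P = cont_maps_D[OF p] and F = cont_maps_D[OF f]
  interpret N: frame N by (rule F(2))
  show ?thesis
  proof (rule cont_mapsI)
    fix A assume A: "A \<subseteq> carrier N"
    then have "f ` A \<subseteq> carrier M" using F(3) by blast
    then have "p (f (\<Squnion>\<^bsub>N\<^esub>A)) = \<Squnion>\<^bsub>L\<^esub>(p ` f ` A)"
      using F(4)[OF A] P(4) by simp
    moreover have "p ` f ` A = compose (carrier N) p f ` A"
      using A by (force simp: compose_def)
    ultimately show "compose (carrier N) p f (\<Squnion>\<^bsub>N\<^esub>A) = \<Squnion>\<^bsub>L\<^esub>(compose (carrier N) p f ` A)"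
      using A by (simp add: compose_def)
  qed (use P F in \<open>auto simp: compose_def\<close>)
qed

text \<open>
  This set is the value at \<open>w\<close> of the right adjoint of \<open>(f, g) : L \<rightarrow> Y \<times> Y\<close>.  It is closed
  under joins in each variable because meets distribute over joins in \<open>L\<close>.
\<close>

lemma rect_ideal_pair:
  assumes f: "f \<in> cont_maps L Y" and g: "g \<in> cont_maps L Z" and w: "w \<in> carrier L"
  shows "rect_ideal Y Z {(y, z). y \<in> carrier Y \<and> z \<in> carrier Z \<and> f y \<sqinter>\<^bsub>L\<^esub> g z \<sqsubseteq>\<^bsub>L\<^esub> w}"
proof -
  note F = cont_maps_D[OF f] and G = cont_maps_D[OF g]
  interpret L: frame L by (rule F(1))
  interpret Y: frame Y by (rule F(2))
  interpret Z: frame Z by (rule G(2))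
  have down: "f y' \<sqinter>\<^bsub>L\<^esub> g z' \<sqsubseteq>\<^bsub>L\<^esub> w"
    if "y \<in> carrier Y" "z \<in> carrier Z" "y' \<in> carrier Y" "z' \<in> carrier Z"
      "y' \<sqsubseteq>\<^bsub>Y\<^esub> y" "z' \<sqsubseteq>\<^bsub>Z\<^esub> z" "f y \<sqinter>\<^bsub>L\<^esub> g z \<sqsubseteq>\<^bsub>L\<^esub> w" for y z y' z'
  proof -
    have "f y' \<sqinter>\<^bsub>L\<^esub> g z' \<sqsubseteq>\<^bsub>L\<^esub> f y"
      using that F(3,7) G(3) L.le_trans[OF L.meet_left[of "f y'" "g z'"], of "f y"] by auto
    moreover have "f y' \<sqinter>\<^bsub>L\<^esub> g z' \<sqsubseteq>\<^bsub>L\<^esub> g z"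
      using that F(3) G(3,7) L.le_trans[OF L.meet_right[of "f y'" "g z'"], of "g z"] by auto
    ultimately have "f y' \<sqinter>\<^bsub>L\<^esub> g z' \<sqsubseteq>\<^bsub>L\<^esub> f y \<sqinter>\<^bsub>L\<^esub> g z"
      using that F(3) G(3) by (intro L.meet_le) auto
    then show ?thesis
      using that F(3) G(3) w L.le_trans[of "f y' \<sqinter>\<^bsub>L\<^esub> g z'" "f y \<sqinter>\<^bsub>L\<^esub> g z" w] by auto
  qed
  have sup: "x \<sqinter>\<^bsub>L\<^esub> \<Squnion>\<^bsub>L\<^esub>A \<sqsubseteq>\<^bsub>L\<^esub> w"
    if "x \<in> carrier L" "A \<subseteq> carrier L" "\<And>a. a \<in> A \<Longrightarrow> x \<sqinter>\<^bsub>L\<^esub> a \<sqsubseteq>\<^bsub>L\<^esub> w" for x A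
    unfolding L.inf_Sup_distrib[OF that(1,2)] using that w by (intro L.sup_least) auto
  have 1: "f (\<Squnion>\<^bsub>Y\<^esub>A) \<sqinter>\<^bsub>L\<^esub> g z \<sqsubseteq>\<^bsub>L\<^esub> w"
    if "A \<subseteq> carrier Y" "z \<in> carrier Z" "\<And>a. a \<in> A \<Longrightarrow> f a \<sqinter>\<^bsub>L\<^esub> g z \<sqsubseteq>\<^bsub>L\<^esub> w" for A z
  proof -
    have "g z \<sqinter>\<^bsub>L\<^esub> \<Squnion>\<^bsub>L\<^esub>(f ` A) \<sqsubseteq>\<^bsub>L\<^esub> w"
      using that F(3) G(3) by (intro sup) (auto simp: meet_comm[of L "g z"])
    then show ?thesis using F(4)[OF that(1)] by (simp add: meet_comm[of L "g z"])
  qed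
  have 2: "f y \<sqinter>\<^bsub>L\<^esub> g (\<Squnion>\<^bsub>Z\<^esub>B) \<sqsubseteq>\<^bsub>L\<^esub> w"
    if "B \<subseteq> carrier Z" "y \<in> carrier Y" "\<And>b. b \<in> B \<Longrightarrow> f y \<sqinter>\<^bsub>L\<^esub> g b \<sqsubseteq>\<^bsub>L\<^esub> w" for B y
    unfolding G(4)[OF that(1)] using that F(3) G(3) by (intro sup) auto
  show ?thesis
    unfolding rect_ideal_def
  proof (intro conjI allI ballI impI)
    fix A z
    assume "A \<subseteq> carrier Y" "z \<in> carrier Z"
      "A \<times> {z} \<subseteq> {(y, z). y \<in> carrier Y \<and> z \<in> carrier Z \<and> f y \<sqinter>\<^bsub>L\<^esub> g z \<sqsubseteq>\<^bsub>L\<^esub> w}"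
    then show "(\<Squnion>\<^bsub>Y\<^esub>A, z) \<in> {(y, z). y \<in> carrier Y \<and> z \<in> carrier Z \<and> f y \<sqinter>\<^bsub>L\<^esub> g z \<sqsubseteq>\<^bsub>L\<^esub> w}"
      by (auto intro!: 1)
  next
    fix y B
    assume "y \<in> carrier Y" "B \<subseteq> carrier Z"
      "{y} \<times> B \<subseteq> {(y, z). y \<in> carrier Y \<and> z \<in> carrier Z \<and> f y \<sqinter>\<^bsub>L\<^esub> g z \<sqsubseteq>\<^bsub>L\<^esub> w}"
    then show "(y, \<Squnion>\<^bsub>Z\<^esub>B) \<in> {(y, z). y \<in> carrier Y \<and> z \<in> carrier Z \<and> f y \<sqinter>\<^bsub>L\<^esub> g z \<sqsubseteq>\<^bsub>L\<^esub> w}"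
      by (auto intro!: 2)
  qed (use down in auto)
qed

text \<open>
  Let \<open>c\<close> be the open complement of the diagonal, the join of all rectangles \<open>y \<times> z\<close> with
  \<open>y \<and> z = \<bottom>\<close>.  The diagonal being the closed complement of \<open>c\<close>, an open \<open>E \<supseteq> c\<close> is
  determined by its restriction to the diagonal.  If \<open>E\<close> contains \<open>u \<times> \<top>\<close>, this restriction
  contains \<open>u\<close>, so \<open>E\<close> contains the other rectangle \<open>\<top> \<times> u\<close> that restricts to \<open>u\<close>.
\<close>

lemma Hausdorff_locale_rect_swap:
  assumes Y: "Hausdorff_locale Y" and E: "rect_ideal Y Y E" and u: "u \<in> carrier Y"
    and disjoint: "\<And>y z. y \<in> carrier Y \<Longrightarrow> z \<in> carrier Y \<Longrightarrow>
      y \<sqinter>\<^bsub>Y\<^esub> z = \<bottom>\<^bsub>Y\<^esub> \<Longrightarrow> (y, z) \<in> E"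
    and uE: "(u, \<top>\<^bsub>Y\<^esub>) \<in> E"
  shows "(\<top>\<^bsub>Y\<^esub>, u) \<in> E"
proof -
  interpret frame Y using Y by (simp add: Hausdorff_locale_def)
  let ?P = "prod_locale Y Y" and ?d = "diagonal Y"
  have carr: "carrier ?P = {D. rect_ideal Y Y D}" and le: "le ?P = (\<subseteq>)"
    by (auto simp: prod_locale_def)
  have d: "?d \<in> cont_maps Y ?P"
    and closed: "\<And>A. closed_sublocale Y A \<Longrightarrow> closed_sublocale ?P (direct_image Y ?P ?d ` A)"
    using Y by (auto simp: Hausdorff_locale_def closed_locale_map_def)
  have rect: "rect_ideal Y Y (direct_image Y ?P ?d x)" for x
    using direct_image_closed[OF d] carr by blast
  have adj: "?d D \<sqsubseteq>\<^bsub>Y\<^esub> x \<longleftrightarrow> D \<subseteq> direct_image Y ?P ?d x" if "x \<in> carrier Y" "rect_ideal Y Y D" for x D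
    using galois_direct_image[OF d] that by (simp add: carr le)
  have d_eq: "?d D = \<Squnion>\<^bsub>Y\<^esub>((\<lambda>(y, z). y \<sqinter>\<^bsub>Y\<^esub> z) ` D)" if "rect_ideal Y Y D" for D
  proof -
    have "(\<lambda>(y, z). id_map Y y \<sqinter>\<^bsub>Y\<^esub> id_map Y z) ` D = (\<lambda>(y, z). y \<sqinter>\<^bsub>Y\<^esub> z) ` D"
      using that by (intro image_cong) (auto simp: id_map_def rect_ideal_def)
    then show ?thesis using that by (simp add: diagonal_def pair_map_def carr)
  qed
  have d_le: "?d D \<sqsubseteq>\<^bsub>Y\<^esub> x \<longleftrightarrow> (\<forall>(y, z)\<in>D. y \<sqinter>\<^bsub>Y\<^esub> z \<sqsubseteq>\<^bsub>Y\<^esub> x)"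
    if x: "x \<in> carrier Y" and D: "rect_ideal Y Y D" for x D
  proof -
    have sub: "(\<lambda>(y, z). y \<sqinter>\<^bsub>Y\<^esub> z) ` D \<subseteq> carrier Y"
      using D by (auto simp: rect_ideal_def)
    show ?thesis
    proof
      assume le: "?d D \<sqsubseteq>\<^bsub>Y\<^esub> x"
      show "\<forall>(y, z)\<in>D. y \<sqinter>\<^bsub>Y\<^esub> z \<sqsubseteq>\<^bsub>Y\<^esub> x"
      proof clarify
        fix y z assume "(y, z) \<in> D"
        then have m: "y \<sqinter>\<^bsub>Y\<^esub> z \<in> (\<lambda>(y, z). y \<sqinter>\<^bsub>Y\<^esub> z) ` D" by (rule rev_image_eqI) simp
        have "y \<sqinter>\<^bsub>Y\<^esub> z \<sqsubseteq>\<^bsub>Y\<^esub> ?d D"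
          unfolding d_eq[OF D] using sub m by (rule sup_upper)
        then show "y \<sqinter>\<^bsub>Y\<^esub> z \<sqsubseteq>\<^bsub>Y\<^esub> x"
        proof (rule le_trans)
          show "?d D \<in> carrier Y" unfolding d_eq[OF D] using sub by (rule sup_closed)
        qed (use le m sub x in auto)
      qed
    qed (auto simp: d_eq[OF D] intro!: sup_least[OF sub x])
  qed
  \<comment> \<open>The whole of \<open>Y\<close> is closed, so its image under the diagonal map is the principal filter
    of some \<open>c\<close>.  As \<open>\<Delta>\<^sub>*(\<bottom>)\<close> lies in this filter, \<open>c\<close> consists of pairs with meet \<open>\<bottom>\<close>.\<close>
  have "closed_sublocale Y (carrier Y)"
    unfolding closed_sublocale_def by (intro bexI[of _ "\<bottom>\<^bsub>Y\<^esub>"]) auto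
  then obtain c where c: "direct_image Y ?P ?d ` carrier Y = {D. rect_ideal Y Y D \<and> c \<subseteq> D}"
    using closed[of "carrier Y"] unfolding closed_sublocale_def carr le by auto
  let ?B = "direct_image Y ?P ?d \<bottom>\<^bsub>Y\<^esub>"
  have "c \<subseteq> ?B" using c by blast
  also have "?B \<subseteq> E"
  proof (rule subrelI)
    fix y z assume yz: "(y, z) \<in> ?B"
    then have "y \<in> carrier Y" "z \<in> carrier Y" using rect[of "\<bottom>\<^bsub>Y\<^esub>"] by (auto simp: rect_ideal_def)
    moreover have "y \<sqinter>\<^bsub>Y\<^esub> z \<sqsubseteq>\<^bsub>Y\<^esub> \<bottom>\<^bsub>Y\<^esub>"
      using d_le[OF _ rect[of "\<bottom>\<^bsub>Y\<^esub>"], of "\<bottom>\<^bsub>Y\<^esub>"] adj[OF _ rect[of "\<bottom>\<^bsub>Y\<^esub>"], of "\<bottom>\<^bsub>Y\<^esub>"] yz by auto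
    ultimately show "(y, z) \<in> E"
      using disjoint bottom_lower[of "y \<sqinter>\<^bsub>Y\<^esub> z"] le_antisym[of "y \<sqinter>\<^bsub>Y\<^esub> z" "\<bottom>\<^bsub>Y\<^esub>"] by auto
  qed
  finally obtain x where x: "x \<in> carrier Y" and Ex: "E = direct_image Y ?P ?d x"
    using c E by blast
  have "u \<sqinter>\<^bsub>Y\<^esub> \<top>\<^bsub>Y\<^esub> \<sqsubseteq>\<^bsub>Y\<^esub> x"
    using adj[OF x E] d_le[OF x E] Ex uE by auto
  moreover have "u \<sqsubseteq>\<^bsub>Y\<^esub> u \<sqinter>\<^bsub>Y\<^esub> \<top>\<^bsub>Y\<^esub>"
    using u by (intro meet_le) auto
  ultimately have ux: "u \<sqsubseteq>\<^bsub>Y\<^esub> x" using u x le_trans[of u "u \<sqinter>\<^bsub>Y\<^esub> \<top>\<^bsub>Y\<^esub>" x] by auto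
  \<comment> \<open>\<open>E = \<Delta>\<^sub>*(x)\<close> with \<open>u \<le> x\<close>, so \<open>E\<close> contains \<open>\<Delta>\<^sub>*(u)\<close>, which is the following set.\<close>
  let ?U = "{(y, z). y \<in> carrier Y \<and> z \<in> carrier Y \<and> id_map Y y \<sqinter>\<^bsub>Y\<^esub> id_map Y z \<sqsubseteq>\<^bsub>Y\<^esub> u}"
  have U: "rect_ideal Y Y ?U"
    using frame_axioms by (intro rect_ideal_pair id_map_cont u)
  have "y \<sqinter>\<^bsub>Y\<^esub> z \<sqsubseteq>\<^bsub>Y\<^esub> x" if "(y, z) \<in> ?U" for y z
    using that ux u x le_trans[of "y \<sqinter>\<^bsub>Y\<^esub> z" u x] by (auto simp: id_map_def)
  then have "?U \<subseteq> E" using adj[OF x U] d_le[OF x U] Ex by auto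
  moreover have "(\<top>\<^bsub>Y\<^esub>, u) \<in> ?U" using u by (simp add: id_map_def meet_right)
  ultimately show ?thesis by blast
qed

text \<open>
  The rectangles \<open>y \<times> z\<close> with \<open>f\<^sup>*(y) \<and> g\<^sup>*(z) \<le> f\<^sup>*(u)\<close> form an open of \<open>Y \<times> Y\<close>.  It
  contains all those with \<open>y \<and> z = \<bottom>\<close>: pulled back further along \<open>d\<close>, where \<open>f\<close> and \<open>g\<close>
  agree, \<open>f\<^sup>*(y) \<and> g\<^sup>*(z)\<close> becomes the inverse image of \<open>y \<and> z\<close>, and by density only \<open>\<bottom>\<close>
  becomes \<open>\<bottom>\<close>.  It also contains \<open>u \<times> \<top>\<close>, hence \<open>\<top> \<times> u\<close>.
\<close>

lemma dense_Hausdorff_le: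
  assumes dense: "dense_map L M d" and Y: "Hausdorff_locale Y"
    and f: "f \<in> cont_maps M Y" and g: "g \<in> cont_maps M Y"
    and eq: "compose (carrier Y) d f = compose (carrier Y) d g" and u: "u \<in> carrier Y"
  shows "g u \<sqsubseteq>\<^bsub>M\<^esub> f u"
proof -
  have d: "d \<in> cont_maps L M" and d0: "direct_image L M d \<bottom>\<^bsub>L\<^esub> = \<bottom>\<^bsub>M\<^esub>"
    using dense by (auto simp: dense_map_def)
  note D = cont_maps_D[OF d] and F = cont_maps_D[OF f] and G = cont_maps_D[OF g]
  interpret L: frame L by (rule D(1))
  interpret M: frame M by (rule D(2))
  interpret Y: frame Y by (rule F(2))
  have eq': "d (f y) = d (g y)" if "y \<in> carrier Y" for y
    using fun_cong[OF eq, of y] that by (simp add: compose_def)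
  have bot: "d (f \<bottom>\<^bsub>Y\<^esub>) \<sqsubseteq>\<^bsub>L\<^esub> \<bottom>\<^bsub>L\<^esub>"
    using F(4)[of "{}"] D(4)[of "{}"] L.sup_least[of "{}" "\<bottom>\<^bsub>L\<^esub>"] Y.weak_sup_empty
      M.weak_sup_empty by (simp add: Y.eq_is_equal M.eq_is_equal)
  let ?E = "{(y, z). y \<in> carrier Y \<and> z \<in> carrier Y \<and> f y \<sqinter>\<^bsub>M\<^esub> g z \<sqsubseteq>\<^bsub>M\<^esub> f u}"
  have E: "rect_ideal Y Y ?E"
    using f g F(3)[OF u] by (rule rect_ideal_pair)
  have "(\<top>\<^bsub>Y\<^esub>, u) \<in> ?E"
  proof (rule Hausdorff_locale_rect_swap[OF Y E u])
    fix y z assume y: "y \<in> carrier Y" and z: "z \<in> carrier Y" and yz: "y \<sqinter>\<^bsub>Y\<^esub> z = \<bottom>\<^bsub>Y\<^esub>"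
    have m: "f y \<sqinter>\<^bsub>M\<^esub> g z \<in> carrier M" using F(3)[OF y] G(3)[OF z] by simp
    have "d (f y \<sqinter>\<^bsub>M\<^esub> g z) = d (f \<bottom>\<^bsub>Y\<^esub>)"
      using D(5) F(3,5) G(3) eq' y z by (simp flip: yz)
    then have "f y \<sqinter>\<^bsub>M\<^esub> g z \<sqsubseteq>\<^bsub>M\<^esub> \<bottom>\<^bsub>M\<^esub>"
      using galois_direct_image[OF d _ m, of "\<bottom>\<^bsub>L\<^esub>"] bot d0 by simp
    then have "f y \<sqinter>\<^bsub>M\<^esub> g z \<sqsubseteq>\<^bsub>M\<^esub> f u"
      using M.le_trans[OF _ M.bottom_lower[OF F(3)[OF u]], of "f y \<sqinter>\<^bsub>M\<^esub> g z"] m F(3)[OF u] by simp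
    then show "(y, z) \<in> ?E" using y z by simp
  next
    show "(u, \<top>\<^bsub>Y\<^esub>) \<in> ?E"
      using u F(3) G(3) by (simp add: M.meet_left)
  qed
  then have "\<top>\<^bsub>M\<^esub> \<sqinter>\<^bsub>M\<^esub> g u \<sqsubseteq>\<^bsub>M\<^esub> f u" using F(6) by simp
  moreover have "g u \<sqsubseteq>\<^bsub>M\<^esub> \<top>\<^bsub>M\<^esub> \<sqinter>\<^bsub>M\<^esub> g u"
    using G(3)[OF u] by (intro M.meet_le) auto
  ultimately show ?thesis
    using F(3)[OF u] G(3)[OF u] M.le_trans[of "g u" "\<top>\<^bsub>M\<^esub> \<sqinter>\<^bsub>M\<^esub> g u" "f u"] by auto
qed

lemma dense_Hausdorff_inj:
  assumes "dense_map L M d" "Hausdorff_locale Y"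
  shows "inj_on (\<lambda>f. compose (carrier Y) d f) (cont_maps M Y)"
proof (rule inj_onI)
  fix f g
  assume f: "f \<in> cont_maps M Y" and g: "g \<in> cont_maps M Y"
    and eq: "compose (carrier Y) d f = compose (carrier Y) d g"
  interpret M: frame M by (rule cont_maps_D(1)[OF f])
  show "f = g"
  proof (rule extensionalityI[of _ "carrier Y"])
    fix u assume u: "u \<in> carrier Y"
    show "f u = g u"
      using dense_Hausdorff_le[OF assms f g eq u] dense_Hausdorff_le[OF assms g f eq[symmetric] u]
        cont_maps_D(3)[OF f u] cont_maps_D(3)[OF g u] by (simp add: M.le_antisym)
  qed (use cont_maps_D(8)[OF f] cont_maps_D(8)[OF g] in auto)
qed


section \<open>The frame of \<open>\<mu>\<close>-ideals\<close>

lemma mu_ideal_Inter: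
  assumes "\<T> \<noteq> {}" "\<And>U. U \<in> \<T> \<Longrightarrow> mu_ideal X \<mu> U"
  shows "mu_ideal X \<mu> (\<Inter>\<T>)"
  unfolding mu_ideal_def
proof (intro conjI allI impI ballI)
  show "\<Inter>\<T> \<subseteq> {K. compactin X K}" using assms unfolding mu_ideal_def by blast
next
  fix K C assume "K \<in> \<Inter>\<T>" "compactin X C \<and> C \<subseteq> K"
  then show "C \<in> \<Inter>\<T>" using assms(2) unfolding mu_ideal_def by blast
next
  fix K \<F>
  assume *: "compactin X K \<and> \<F> \<subseteq> \<Inter>\<T> \<and> (\<forall>C\<in>\<F>. C \<subseteq> K) \<and>
        (\<forall>\<epsilon>>0. \<exists>F. finite F \<and> F \<subseteq> \<F> \<and> \<mu> K - \<mu> (\<Union>F) < \<epsilon>)"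
  show "K \<in> \<Inter>\<T>"
  proof
    fix U assume U: "U \<in> \<T>"
    then have "\<F> \<subseteq> U" using * by blast
    then show "K \<in> U" using * assms(2)[OF U] unfolding mu_ideal_def by blast
  qed
qed

lemma mu_ideal_compacts: "mu_ideal X \<mu> {K. compactin X K}"
  unfolding mu_ideal_def by auto

lemma mu_ideal_hull:
  assumes "D \<subseteq> {K. compactin X K}" shows "mu_ideal X \<mu> (mu_ideal X \<mu> hull D)"
  unfolding hull_def using assms mu_ideal_compacts[of X \<mu>] by (intro mu_ideal_Inter) auto

lemma mu_ideal_Un:
  assumes "mu_ideal X \<mu> U" "K \<in> U" "L \<in> U"
  shows "K \<union> L \<in> U"
proof -
  have "compactin X (K \<union> L)" using assms by (auto simp: mu_ideal_def intro: compactin_Un)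
  moreover have "\<forall>\<epsilon>>0. \<exists>F. finite F \<and> F \<subseteq> {K, L} \<and> \<mu> (K \<union> L) - \<mu> (\<Union>F) < \<epsilon>"
    by (intro allI impI exI[of _ "{K, L}"]) auto
  ultimately show ?thesis
    using assms unfolding mu_ideal_def
    by (metis (no_types, lifting) Un_upper1 Un_upper2 empty_iff empty_subsetI insert_iff insert_subset)
qed

lemma mu_ideal_empty:
  assumes "mu_ideal X \<mu> U"
  shows "{} \<in> U"
proof -
  have "\<forall>\<epsilon>>0. \<exists>F. finite F \<and> F \<subseteq> {} \<and> \<mu> {} - \<mu> (\<Union>F) < \<epsilon>" by auto
  then show ?thesis using assms compactin_empty[of X] unfolding mu_ideal_def by blast
qed

text \<open>
  The candidate for Heyting implication \<open>V \<rightarrow> W\<close> in the frame of \<open>\<mu>\<close>-ideals.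
\<close>

definition mu_imp :: "'a topology \<Rightarrow> ('a set \<Rightarrow> real) \<Rightarrow> 'a set set \<Rightarrow> 'a set set \<Rightarrow> 'a set set" where
  "mu_imp X \<mu> V W = {K. compactin X K \<and> (\<forall>C\<in>V. C \<subseteq> K \<longrightarrow> C \<in> W)}"

context
  fixes X :: "'a topology" and \<mu> :: "'a set \<Rightarrow> real"
  assumes X: "Hausdorff_space X" and \<mu>: "radon_valuation X \<mu>"
begin

lemma valuation_nonneg: "compactin X C \<Longrightarrow> 0 \<le> \<mu> C"
  and valuation_mono: "compactin X C \<Longrightarrow> compactin X D \<Longrightarrow> C \<subseteq> D \<Longrightarrow> \<mu> C \<le> \<mu> D"
  and valuation_empty: "\<mu> {} = 0"
  and valuation_modular:
    "compactin X C \<Longrightarrow> compactin X D \<Longrightarrow> \<mu> C + \<mu> D = \<mu> (C \<union> D) + \<mu> (C \<inter> D)"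
  using \<mu> by (simp_all add: radon_valuation_def)

text \<open>
  Approximate covers restrict to smaller compacts: by modularity,
  \<open>\<mu>(C) - \<mu>(C \<inter> D) = \<mu>(C \<union> D) - \<mu>(D) \<le> \<mu>(K) - \<mu>(D)\<close> for \<open>C, D \<subseteq> K\<close>.  Allowing
  any downward closed \<open>V\<close> lets implication compare a set of generators with the ideal that it
  generates.
\<close>

lemma mu_ideal_imp:
  assumes V: "V \<subseteq> {K. compactin X K}" "\<And>K C. K \<in> V \<Longrightarrow> compactin X C \<Longrightarrow> C \<subseteq> K \<Longrightarrow> C \<in> V"
    and W: "mu_ideal X \<mu> W"
  shows "mu_ideal X \<mu> (mu_imp X \<mu> V W)"
  unfolding mu_ideal_def
proof (intro conjI allI impI ballI)
  fix K \<F>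
  assume *: "compactin X K \<and> \<F> \<subseteq> mu_imp X \<mu> V W \<and> (\<forall>C\<in>\<F>. C \<subseteq> K) \<and>
        (\<forall>\<epsilon>>0. \<exists>F. finite F \<and> F \<subseteq> \<F> \<and> \<mu> K - \<mu> (\<Union>F) < \<epsilon>)"
  have "C \<in> W" if C: "C \<in> V" "C \<subseteq> K" for C
  proof -
    have cC: "compactin X C" using C V by auto
    have "(\<inter>) C ` \<F> \<subseteq> W"
    proof (rule image_subsetI)
      fix B assume B: "B \<in> \<F>"
      then have "compactin X (C \<inter> B)"
        using * cC compactin_Int[OF X] by (auto simp: mu_imp_def)
      then show "C \<inter> B \<in> W" using B * V(2)[OF C(1), of "C \<inter> B"] by (auto simp: mu_imp_def)
    qed
    moreover have "\<forall>B\<in>(\<inter>) C ` \<F>. B \<subseteq> C" by auto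
    moreover have "\<exists>G. finite G \<and> G \<subseteq> (\<inter>) C ` \<F> \<and> \<mu> C - \<mu> (\<Union>G) < \<epsilon>" if \<epsilon>: "\<epsilon> > 0" for \<epsilon>
    proof -
      obtain F where F: "finite F" "F \<subseteq> \<F>" "\<mu> K - \<mu> (\<Union>F) < \<epsilon>"
        using *[THEN conjunct2, THEN conjunct2, THEN conjunct2, rule_format, OF \<epsilon>] by blast
      have cF: "compactin X (\<Union>F)"
        using F * by (intro compactin_Union) (auto simp: mu_imp_def)
      have "\<mu> (C \<union> \<Union>F) \<le> \<mu> K"
        using F(2) * C cC cF by (intro valuation_mono compactin_Un) auto
      then have "\<mu> C - \<mu> (C \<inter> \<Union>F) < \<epsilon>"
        using F(3) valuation_modular[OF cC cF] by linarith
      moreover have "\<Union>((\<inter>) C ` F) = C \<inter> \<Union>F" by auto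
      ultimately show ?thesis
        using F by (intro exI[of _ "(\<inter>) C ` F"]) auto
    qed
    ultimately show ?thesis using W cC unfolding mu_ideal_def by blast
  qed
  then show "K \<in> mu_imp X \<mu> V W" using * by (simp add: mu_imp_def)
qed (auto simp: mu_imp_def)

text \<open>
  Generating ideals from downward closed sets commutes with binary intersection.  This gives both
  the frame law for \<open>\<mu>\<close>-ideals and the preservation of meets by \<open>p\<^sub>\<mu>\<^sup>*\<close>.
\<close>

lemma hull_Int_subset:
  assumes D: "D \<subseteq> {K. compactin X K}" "\<And>K C. K \<in> D \<Longrightarrow> compactin X C \<Longrightarrow> C \<subseteq> K \<Longrightarrow> C \<in> D"
    and B: "B \<subseteq> {K. compactin X K}" "\<And>K C. K \<in> B \<Longrightarrow> compactin X C \<Longrightarrow> C \<subseteq> K \<Longrightarrow> C \<in> B"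
  shows "(mu_ideal X \<mu> hull D) \<inter> (mu_ideal X \<mu> hull B) \<subseteq> mu_ideal X \<mu> hull (D \<inter> B)"
proof -
  let ?H = "mu_ideal X \<mu> hull (D \<inter> B)" and ?HB = "mu_ideal X \<mu> hull B"
  have H: "mu_ideal X \<mu> ?H" and HB: "mu_ideal X \<mu> ?HB"
    using D(1) B(1) by (auto intro!: mu_ideal_hull)
  \<comment> \<open>Adjointness of implication lets one factor of the intersection at a time be replaced
    by the ideal it generates.\<close>
  have "B \<subseteq> mu_imp X \<mu> D ?H"
    using B D(1) by (auto simp: mu_imp_def intro!: hull_inc)
  then have *: "?HB \<subseteq> mu_imp X \<mu> D ?H"
    using mu_ideal_imp[OF D H] by (rule hull_minimal)
  have HB': "?HB \<subseteq> {K. compactin X K}"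
    "\<And>K C. K \<in> ?HB \<Longrightarrow> compactin X C \<Longrightarrow> C \<subseteq> K \<Longrightarrow> C \<in> ?HB"
    using HB unfolding mu_ideal_def by blast+
  have "D \<subseteq> mu_imp X \<mu> ?HB ?H"
  proof
    fix K assume K: "K \<in> D"
    have "C \<in> ?H" if C: "C \<in> ?HB" "C \<subseteq> K" for C
    proof -
      have "C \<in> D" using D(2)[OF K] C HB'(1) by blast
      then show ?thesis using * C by (auto simp: mu_imp_def)
    qed
    then show "K \<in> mu_imp X \<mu> ?HB ?H" using K D(1) by (auto simp: mu_imp_def)
  qed
  then have "mu_ideal X \<mu> hull D \<subseteq> mu_imp X \<mu> ?HB ?H"
    using mu_ideal_imp[OF HB' H] by (rule hull_minimal)
  then show ?thesis by (auto simp: mu_imp_def)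
qed

lemma set_frame_mu_ideals:
  "set_frame {U. mu_ideal X \<mu> U} (\<lambda>A. mu_ideal X \<mu> hull \<Union>A)"
proof
  fix A assume A: "A \<subseteq> {U. mu_ideal X \<mu> U}"
  then have A': "\<Union>A \<subseteq> {K. compactin X K}" unfolding mu_ideal_def by blast
  show "mu_ideal X \<mu> hull \<Union>A \<in> {U. mu_ideal X \<mu> U}"
    using mu_ideal_hull[OF A'] by simp
  show "U \<subseteq> mu_ideal X \<mu> hull \<Union>A" if "U \<in> A" for U
    using that hull_subset[of "\<Union>A" "mu_ideal X \<mu>"] by blast
  show "mu_ideal X \<mu> hull \<Union>A \<subseteq> B"
    if "B \<in> {U. mu_ideal X \<mu> U}" "\<And>U. U \<in> A \<Longrightarrow> U \<subseteq> B" for B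
    using that by (intro hull_minimal) auto
  show "V \<inter> (mu_ideal X \<mu> hull \<Union>A) \<subseteq> mu_ideal X \<mu> hull \<Union>((\<inter>) V ` A)"
    if V: "V \<in> {U. mu_ideal X \<mu> U}" for V
  proof -
    have "(mu_ideal X \<mu> hull V) \<inter> (mu_ideal X \<mu> hull \<Union>A) \<subseteq> mu_ideal X \<mu> hull (V \<inter> \<Union>A)"
    proof (rule hull_Int_subset[OF _ _ A'])
      show "\<And>K C. K \<in> \<Union>A \<Longrightarrow> compactin X C \<Longrightarrow> C \<subseteq> K \<Longrightarrow> C \<in> \<Union>A"
        using A unfolding mu_ideal_def by blast
    qed (use V in \<open>unfold mu_ideal_def, blast+\<close>)
    moreover have "V \<inter> \<Union>A = \<Union>((\<inter>) V ` A)" by blast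
    moreover have "mu_ideal X \<mu> hull V = V" using V by (intro hull_same) simp
    ultimately show ?thesis by (simp only:)
  qed
next
  fix U V assume "U \<in> {U. mu_ideal X \<mu> U}" "V \<in> {U. mu_ideal X \<mu> U}"
  then show "U \<inter> V \<in> {U. mu_ideal X \<mu> U}"
    using mu_ideal_Inter[of "{U, V}" X \<mu>] by auto
qed

text \<open>
  Finite unions of null sets are null, so a compact set approximated by them is null too.
\<close>

lemma mu_ideal_null: "mu_ideal X \<mu> {K. compactin X K \<and> \<mu> K = 0}"
  unfolding mu_ideal_def
proof (intro conjI allI impI ballI)
  fix K C assume "K \<in> {K. compactin X K \<and> \<mu> K = 0}" "compactin X C \<and> C \<subseteq> K"
  then show "C \<in> {K. compactin X K \<and> \<mu> K = 0}"
    using valuation_mono[of C K] valuation_nonneg[of C] by auto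
next
  fix K \<F>
  assume *: "compactin X K \<and> \<F> \<subseteq> {K. compactin X K \<and> \<mu> K = 0} \<and> (\<forall>C\<in>\<F>. C \<subseteq> K) \<and>
        (\<forall>\<epsilon>>0. \<exists>F. finite F \<and> F \<subseteq> \<F> \<and> \<mu> K - \<mu> (\<Union>F) < \<epsilon>)"
  have null: "compactin X (\<Union>F) \<and> \<mu> (\<Union>F) = 0" if "finite F" "F \<subseteq> \<F>" for F
    using that
  proof (induction F rule: finite_induct)
    case empty
    then show ?case using valuation_empty by simp
  next
    case (insert C F)
    then have C: "compactin X C" "\<mu> C = 0" and F: "compactin X (\<Union>F)" "\<mu> (\<Union>F) = 0"
      using * by auto
    then show ?case
      using valuation_modular[OF C(1) F(1)] compactin_Un[OF C(1) F(1)]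
        valuation_nonneg[OF compactin_Un[OF C(1) F(1)]]
        valuation_nonneg[OF compactin_Int[OF X C(1) F(1)]] by simp
  qed
  have "\<mu> K \<le> 0 + \<epsilon>" if "\<epsilon> > 0" for \<epsilon>
    using * null that by (smt (verit))
  then have "\<mu> K \<le> 0" by (rule field_le_epsilon)
  then show "K \<in> {K. compactin X K \<and> \<mu> K = 0}" using * valuation_nonneg[of K] by auto
qed auto

end


section \<open>The map \<open>p\<^sub>\<mu>\<close>\<close>

lemma compactin_split:
  assumes X: "Hausdorff_space X" and K: "compactin X K" "K \<subseteq> V \<union> W"
    and "openin X V" "openin X W"
  obtains K1 K2 where "compactin X K1" "compactin X K2" "K1 \<subseteq> V" "K2 \<subseteq> W" "K = K1 \<union> K2"
proof -
  have diff: "compactin X (K - U)" if "openin X U" for U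
  proof -
    have "closedin X (topspace X - U)" using that by auto
    then have "compactin X ((topspace X - U) \<inter> K)" using K(1) by (rule closed_Int_compactin)
    moreover have "(topspace X - U) \<inter> K = K - U" using compactin_subset_topspace[OF K(1)] by auto
    ultimately show ?thesis by simp
  qed
  obtain A B where AB: "openin X A" "openin X B" "K - V \<subseteq> A" "K - W \<subseteq> B" "disjnt A B"
    using Hausdorff_space_compact_separation[OF X diff diff, of V W] assms
    by (auto simp: disjnt_iff)
  show ?thesis
    by (rule that[of "K - A" "K - B"]) (use AB diff in \<open>auto simp: disjnt_iff\<close>)
qed

text \<open>
  This is why \<open>p\<^sub>\<mu>\<^sup>*\<close> preserves joins: a compact subset of a finite union of open sets splits
  into compact subsets of its members, and ideals are closed under finite unions.
\<close>

lemma mu_ideal_compact_cover: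
  assumes X: "Hausdorff_space X" and J: "mu_ideal X \<mu> J"
    and "\<And>V. V \<in> \<V> \<Longrightarrow> openin X V"
    and "\<And>V K. V \<in> \<V> \<Longrightarrow> compactin X K \<Longrightarrow> K \<subseteq> V \<Longrightarrow> K \<in> J"
    and K: "compactin X K" "K \<subseteq> \<Union>\<V>"
  shows "K \<in> J"
proof -
  obtain \<W> where \<W>: "finite \<W>" "\<W> \<subseteq> \<V>" "K \<subseteq> \<Union>\<W>"
    using K assms(3) unfolding compactin_def by meson
  have "K \<in> J" if "compactin X K" "K \<subseteq> \<Union>\<W>" for K
    using \<W>(1,2) that
  proof (induction \<W> arbitrary: K rule: finite_induct)
    case empty
    then show ?case using mu_ideal_empty[OF J] by simp
  next
    case (insert V \<W>)
    obtain K1 K2 where "compactin X K1" "compactin X K2" "K1 \<subseteq> V" "K2 \<subseteq> \<Union>\<W>" "K = K1 \<union> K2"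
      using compactin_split[OF X, of K V "\<Union>\<W>"] insert.prems assms(3)
      by (metis Union_insert insert_subset openin_Union subset_iff)
    then show ?case
      using insert.IH[of K2] insert.prems(1) assms(4)[of V K1] by (auto intro: mu_ideal_Un[OF J])
  qed
  then show ?thesis using K(1) \<W>(3) by blast
qed

lemma p_map_cont:
  assumes X: "Hausdorff_space X" and \<mu>: "radon_valuation X \<mu>"
  shows "p_map X \<mu> \<in> cont_maps (valuation_locale X \<mu>) (opens_locale X)"
proof -
  interpret V: set_frame "{U. mu_ideal X \<mu> U}" "\<lambda>A. mu_ideal X \<mu> hull \<Union>A"
    using X \<mu> by (rule set_frame_mu_ideals)
  interpret O: set_frame "{U. openin X U}" \<Union> by (rule set_frame_opens)
  let ?D = "\<lambda>V. {K. compactin X K \<and> K \<subseteq> V}"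
  have p: "p_map X \<mu> V = mu_ideal X \<mu> hull ?D V" if "openin X V" for V
    using that by (simp add: p_map_def)
  have ideal: "mu_ideal X \<mu> (p_map X \<mu> V)" if "openin X V" for V
    unfolding p[OF that] by (rule mu_ideal_hull) auto
  show ?thesis
    unfolding valuation_locale_def opens_locale_def
  proof (rule cont_mapsI)
    fix A assume "A \<subseteq> carrier (incl_order {U. openin X U})"
    then have A: "A \<subseteq> {U. openin X U}" by simp
    then have op: "openin X (\<Union>A)" by auto
    have pA: "p_map X \<mu> ` A \<subseteq> {U. mu_ideal X \<mu> U}" using A ideal by auto
    let ?H = "mu_ideal X \<mu> hull \<Union>(p_map X \<mu> ` A)"
    have H: "mu_ideal X \<mu> ?H" using V.S_closed[OF pA] by simp
    have "?D (\<Union>A) \<subseteq> ?H"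
    proof (intro subsetI, rule mu_ideal_compact_cover[OF X H, of A])
      fix V K assume "V \<in> A" "compactin X K" "K \<subseteq> V"
      then have "K \<in> p_map X \<mu> V" using A p[of V] by (auto intro: hull_inc)
      then show "K \<in> ?H" using V.S_upper[OF pA] \<open>V \<in> A\<close> by blast
    qed (use A in auto)
    then have "p_map X \<mu> (\<Union>A) \<subseteq> ?H" unfolding p[OF op] using H by (rule hull_minimal)
    moreover have "?H \<subseteq> p_map X \<mu> (\<Union>A)"
    proof (rule hull_minimal, rule UN_least)
      fix V assume V: "V \<in> A"
      then have "openin X V" using A by blast
      show "p_map X \<mu> V \<subseteq> p_map X \<mu> (\<Union>A)"
        unfolding p[OF \<open>openin X V\<close>] p[OF op] using V by (intro hull_mono) blast
    qed (rule ideal[OF op])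
    ultimately show "p_map X \<mu> (\<Squnion>\<^bsub>incl_order {U. openin X U}\<^esub>A)
        = \<Squnion>\<^bsub>incl_order {U. mu_ideal X \<mu> U}\<^esub>(p_map X \<mu> ` A)"
      by (simp only: O.sup_eq[OF A] V.sup_eq[OF pA])
  next
    fix y z assume "y \<in> carrier (incl_order {U. openin X U})" "z \<in> carrier (incl_order {U. openin X U})"
    then have y: "openin X y" and z: "openin X z" and yz: "openin X (y \<inter> z)" by auto
    have "?D y \<inter> ?D z = ?D (y \<inter> z)" by auto
    then have "p_map X \<mu> y \<inter> p_map X \<mu> z \<subseteq> p_map X \<mu> (y \<inter> z)"
      using hull_Int_subset[OF X \<mu>, of "?D y" "?D z"] unfolding p[OF y] p[OF z] p[OF yz] by auto
    moreover have "p_map X \<mu> (y \<inter> z) \<subseteq> p_map X \<mu> y \<inter> p_map X \<mu> z"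
      unfolding p[OF y] p[OF z] p[OF yz] by (intro Int_greatest hull_mono) auto
    ultimately show "p_map X \<mu> (y \<sqinter>\<^bsub>incl_order {U. openin X U}\<^esub> z)
        = p_map X \<mu> y \<sqinter>\<^bsub>incl_order {U. mu_ideal X \<mu> U}\<^esub> p_map X \<mu> z"
      using O.meet_eq V.meet_eq y z ideal by auto
  next
    have top: "\<top>\<^bsub>incl_order {U. openin X U}\<^esub> = topspace X"
      by (rule O.top_eq) (auto simp: openin_subset)
    have "?D (topspace X) = {K. compactin X K}" by (auto dest: compactin_subset_topspace)
    then have "p_map X \<mu> (topspace X) = {K. compactin X K}"
      using p[of "topspace X"] hull_same[of "mu_ideal X \<mu>" "{K. compactin X K}"] mu_ideal_compacts[of X \<mu>] by simp
    moreover have "\<top>\<^bsub>incl_order {U. mu_ideal X \<mu> U}\<^esub> = {K. compactin X K}"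
      using mu_ideal_compacts[of X \<mu>] by (intro V.top_eq) (auto simp: mu_ideal_def)
    ultimately show "p_map X \<mu> \<top>\<^bsub>incl_order {U. openin X U}\<^esub> = \<top>\<^bsub>incl_order {U. mu_ideal X \<mu> U}\<^esub>"
      by (simp only: top)
  qed (use V.frame O.frame ideal in \<open>auto simp: p_map_def\<close>)
qed

lemma p_map_dense:
  assumes X: "Hausdorff_space X" and \<mu>: "radon_valuation X \<mu>"
    and pos: "\<And>U. openin X U \<Longrightarrow> U \<noteq> {} \<Longrightarrow> \<exists>K. compactin X K \<and> K \<subseteq> U \<and> \<mu> K > 0"
  shows "dense_map (valuation_locale X \<mu>) (opens_locale X) (p_map X \<mu>)"
proof -
  interpret V: set_frame "{U. mu_ideal X \<mu> U}" "\<lambda>A. mu_ideal X \<mu> hull \<Union>A"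
    using X \<mu> by (rule set_frame_mu_ideals)
  interpret O: set_frame "{U. openin X U}" \<Union> by (rule set_frame_opens)
  let ?P = "{V. openin X V \<and> p_map X \<mu> V \<subseteq> \<bottom>\<^bsub>valuation_locale X \<mu>\<^esub>}"
  have "\<bottom>\<^bsub>valuation_locale X \<mu>\<^esub> = mu_ideal X \<mu> hull {}"
    unfolding valuation_locale_def
    by (rule V.bottom_eq) (simp_all add: mu_ideal_hull hull_minimal)
  also have "\<dots> \<subseteq> {K. compactin X K \<and> \<mu> K = 0}"
    using mu_ideal_null[OF X \<mu>] by (intro hull_minimal) auto
  finally have null: "\<bottom>\<^bsub>valuation_locale X \<mu>\<^esub> \<subseteq> {K. compactin X K \<and> \<mu> K = 0}" .
  have "V = {}" if "V \<in> ?P" for V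
  proof (rule ccontr)
    assume "V \<noteq> {}"
    then obtain K where K: "compactin X K" "K \<subseteq> V" "\<mu> K > 0" using pos \<open>V \<in> ?P\<close> by blast
    then have "K \<in> p_map X \<mu> V" using \<open>V \<in> ?P\<close> by (auto simp: p_map_def intro: hull_inc)
    then show False using K(3) null \<open>V \<in> ?P\<close> by auto
  qed
  then have "\<Union>?P = {}" by blast
  moreover have "direct_image (valuation_locale X \<mu>) (opens_locale X) (p_map X \<mu>)
      \<bottom>\<^bsub>valuation_locale X \<mu>\<^esub> = \<Union>?P"
    using O.sup_eq[of ?P] by (auto simp: direct_image_def opens_locale_def valuation_locale_def)
  moreover have "\<bottom>\<^bsub>opens_locale X\<^esub> = {}"
    unfolding opens_locale_def by (rule O.bottom_eq) auto
  ultimately show ?thesis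
    using p_map_cont[OF X \<mu>] by (simp add: dense_map_def)
qed

lemma inner_val_pos_iff:
  "inner_val X \<mu> U > 0 \<longleftrightarrow> (\<exists>K. compactin X K \<and> K \<subseteq> U \<and> \<mu> K > 0)"
  by (auto simp: inner_val_def less_SUP_iff)

theorem proposition1p15:
  fixes X :: "'a topology" and \<mu> :: "'a set \<Rightarrow> real"
    and Y :: "('b, 'c) gorder_scheme"
  assumes "Hausdorff_space X"
    and "radon_valuation X \<mu>"
  shows "((\<forall>U. openin X U \<and> U \<noteq> {} \<longrightarrow> inner_val X \<mu> U > 0) \<longleftrightarrow>
          (\<forall>U. openin X U \<and> U \<noteq> {} \<longrightarrow> (\<exists>K. compactin X K \<and> K \<subseteq> U \<and> \<mu> K > 0))) \<and>
         ((\<forall>U. openin X U \<and> U \<noteq> {} \<longrightarrow> inner_val X \<mu> U > 0) \<longrightarrow>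
            dense_map (valuation_locale X \<mu>) (opens_locale X) (p_map X \<mu>) \<and>
            (Hausdorff_locale Y \<longrightarrow>
               (\<lambda>f. compose (carrier Y) (p_map X \<mu>) f)
                 \<in> cont_maps (opens_locale X) Y \<rightarrow> cont_maps (valuation_locale X \<mu>) Y \<and>
               inj_on (\<lambda>f. compose (carrier Y) (p_map X \<mu>) f) (cont_maps (opens_locale X) Y)))"
proof -
  let ?pos = "\<forall>U. openin X U \<and> U \<noteq> {} \<longrightarrow> inner_val X \<mu> U > 0"
  have dense: "dense_map (valuation_locale X \<mu>) (opens_locale X) (p_map X \<mu>)" if ?pos
    using that assms by (intro p_map_dense) (auto simp: inner_val_pos_iff)
  have "(\<lambda>f. compose (carrier Y) (p_map X \<mu>) f)
      \<in> cont_maps (opens_locale X) Y \<rightarrow> cont_maps (valuation_locale X \<mu>) Y"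
    using p_map_cont[OF assms] by (auto intro: compose_cont_maps)
  moreover have "inj_on (\<lambda>f. compose (carrier Y) (p_map X \<mu>) f) (cont_maps (opens_locale X) Y)"
    if ?pos "Hausdorff_locale Y"
    using dense[OF that(1)] that(2) by (rule dense_Hausdorff_inj)
  ultimately show ?thesis
    using dense by (simp add: inner_val_pos_iff)
qed

end
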